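(* Let $R$ be a commutative ring with nonzero identity, $M$ an $R$-module and $N$ a proper submodule of $M$. The following conditions are equivalent: (1) $N$ is a weakly classical prime submodule of $M$; (2) for every $a,b\in R$, $(N:_M ab)=(0:_M ab)\cup(N:_M a)\cup(N:_M b)$; (3) for every $a\in R$ and $m\in M$ with $am\notin N$, $(N:_R am)=(0:_R am)\cup(N:_R m)$; (4) for every $a\in R$ and $m\in M$ with $am\notin N$, $(N:_R am)=(0:_R am)$ or $(N:_R am)=(N:_R m)$; (5) for every $a\in R$, every ideal $I$ of $R$ and every $m\in M$ with $0\neq aIm\subseteq N$, either $am\in N$ or $Im\subseteq N$; (6) for every ideal $I$ of $R$ and $m\in M$ with $Im\nsubseteq N$, $(N:_R Im)=(0:_R Im)$ or $(N:_R Im)=(N:_R m)$; (7) for all ideals $I,J$ of $R$ and $m\in M$ with $0\neq IJm\subseteq N$, either $Im\subseteq N$ or $Jm\subseteq N$.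
   Context: All rings are commutative with nonzero identity and all modules are unitary. A proper submodule $N$ of an $R$-module $M$ is weakly classical prime if whenever $a,b\in R$ and $m\in M$ with $0\neq abm\in N$, then $am\in N$ or $bm\in N$. For $a\in R$ and a submodule $N$ of $M$, $(N:_M a)=\{m\in M\mid am\in N\}$. For $m\in M$, $(N:_R m)=\{r\in R\mid rm\in N\}$; for a subset $X$ of $M$, $(N:_R X)=\{r\in R\mid rX\subseteq N\}$. Here $0$ also denotes the zero submodule, and $0\neq aIm$ (resp. $0\neq IJm$) means that the submodule $aIm$ (resp. $IJm$) is not the zero submodule. *)

theory Defs
  imports "HOL-Algebra.Module" "HOL-Algebra.Ideal_Product"
begin

definition weakly_classical_prime ::
  "('r, 'p) ring_scheme \<Rightarrow> ('r, 'm, 'q) module_scheme \<Rightarrow> 'm set \<Rightarrow> bool" where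
  "weakly_classical_prime R M N \<longleftrightarrow>
     submodule N R M \<and> N \<noteq> carrier M \<and>
     (\<forall>a \<in> carrier R. \<forall>b \<in> carrier R. \<forall>m \<in> carrier M.
        (a \<otimes>\<^bsub>R\<^esub> b) \<odot>\<^bsub>M\<^esub> m \<noteq> \<zero>\<^bsub>M\<^esub> \<longrightarrow> (a \<otimes>\<^bsub>R\<^esub> b) \<odot>\<^bsub>M\<^esub> m \<in> N \<longrightarrow>
        a \<odot>\<^bsub>M\<^esub> m \<in> N \<or> b \<odot>\<^bsub>M\<^esub> m \<in> N)"

text \<open>The three residuals $(N :_M a)$, $(N :_R m)$ and $(N :_R X)$.\<close>

definition colon_module :: "('r, 'm, 'q) module_scheme \<Rightarrow> 'm set \<Rightarrow> 'r \<Rightarrow> 'm set" where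
  "colon_module M N a = {m \<in> carrier M. a \<odot>\<^bsub>M\<^esub> m \<in> N}"

definition colon_elem ::
  "('r, 'p) ring_scheme \<Rightarrow> ('r, 'm, 'q) module_scheme \<Rightarrow> 'm set \<Rightarrow> 'm \<Rightarrow> 'r set" where
  "colon_elem R M N m = {r \<in> carrier R. r \<odot>\<^bsub>M\<^esub> m \<in> N}"

definition colon_set ::
  "('r, 'p) ring_scheme \<Rightarrow> ('r, 'm, 'q) module_scheme \<Rightarrow> 'm set \<Rightarrow> 'm set \<Rightarrow> 'r set" where
  "colon_set R M N X = {r \<in> carrier R. (\<lambda>x. r \<odot>\<^bsub>M\<^esub> x) ` X \<subseteq> N}"

text \<open>
  The products $aX$ and $Im$. The set of products is already a submodule when $X$ is a submodule
  (and $R$ is commutative), respectively when $I$ is an ideal, so no span is taken.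
\<close>

definition scalar_smult :: "('r, 'm, 'q) module_scheme \<Rightarrow> 'r \<Rightarrow> 'm set \<Rightarrow> 'm set" where
  "scalar_smult M a X = (\<lambda>x. a \<odot>\<^bsub>M\<^esub> x) ` X"

definition ideal_smult :: "('r, 'm, 'q) module_scheme \<Rightarrow> 'r set \<Rightarrow> 'm \<Rightarrow> 'm set" where
  "ideal_smult M I m = (\<lambda>r. r \<odot>\<^bsub>M\<^esub> m) ` I"

end

theory Submission
  imports Defs
begin

text \<open>
  Each colon condition says that an ideal \<open>(N : X)\<close> is covered by the two ideals \<open>(0 : X)\<close> and
  \<open>(N : m)\<close>, and an additive group covered by two subgroups equals one of them. So the pointwise
  implication for ring elements turns into an alternative between whole ideals, which can then be
  tested on an ideal \<open>I\<close> instead of an element. Principal ideals lead back from ideals to elements.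
\<close>

section \<open>Unions of two subgroups or ideals, and products of ideals\<close>

lemma (in group) subgroup_eq_union_cases:
  assumes "subgroup B G" "subgroup C G" "subgroup (B \<union> C) G"
  shows "B \<union> C = B \<or> B \<union> C = C"
proof (rule ccontr)
  assume "\<not> ?thesis"
  then obtain b c where b: "b \<in> B" "b \<notin> C" and c: "c \<in> C" "c \<notin> B"
    by blast
  have carr: "b \<in> carrier G" "c \<in> carrier G"
    using b c assms subgroup.mem_carrier by metis+
  \<comment> \<open>Whichever subgroup contains the product, cancelling the factor already known to
    lie in it puts the other factor there as well, against the choice of \<open>b\<close> and
    \<open>c\<close>.\<close>
  have "b \<otimes> c \<in> B \<union> C"
    using subgroup.m_closed[OF assms(3)] b c by blast
  then show False
  proof
    assume "b \<otimes> c \<in> B"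
    then have "inv b \<otimes> (b \<otimes> c) \<in> B"
      using assms(1) b by (simp add: subgroup.m_closed subgroup.m_inv_closed)
    then show False using carr c by (simp add: m_assoc [symmetric])
  next
    assume "b \<otimes> c \<in> C"
    then have "(b \<otimes> c) \<otimes> inv c \<in> C"
      using assms(2) c by (simp add: subgroup.m_closed subgroup.m_inv_closed)
    then show False using carr b by (simp add: m_assoc)
  qed
qed

text \<open>Ideals are additive subgroups, so this is the group statement for the additive group of
  \<open>R\<close>. In its uses the union is an ideal because it equals a residual.\<close>

lemma ideal_eq_union_cases:
  assumes "ideal I R" "ideal J R" "ideal (I \<union> J) R"
  shows "I \<union> J = I \<or> I \<union> J = J"
proof -
  interpret ideal I R by fact
  show ?thesis
    using assms
    by (intro add.subgroup_eq_union_cases additive_subgroup.a_subgroup ideal.axioms(1))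
qed

text \<open>The product ideal is generated inductively from the products
  \<open>i \<otimes> j\<close> by sums, so additive closure of \<open>K\<close> carries the
  induction.\<close>

lemma (in ring) ideal_prod_subset_iff:
  assumes "ideal K R"
  shows "ideal_prod R I J \<subseteq> K \<longleftrightarrow> (\<forall>i\<in>I. \<forall>j\<in>J. i \<otimes> j \<in> K)"
proof
  assume "ideal_prod R I J \<subseteq> K"
  then show "\<forall>i\<in>I. \<forall>j\<in>J. i \<otimes> j \<in> K"
    by (auto intro: ideal_prod.prod)
next
  assume *: "\<forall>i\<in>I. \<forall>j\<in>J. i \<otimes> j \<in> K"
  show "ideal_prod R I J \<subseteq> K"
  proof
    fix s assume "s \<in> ideal_prod R I J"
    then show "s \<in> K"
      by induction (use * assms in \<open>auto simp: additive_subgroup.a_closed ideal.axioms(1)\<close>)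
  qed
qed

section \<open>Residuals as ideals, and inclusions of submodules read as inclusions of
  ideals\<close>

context module
begin

text \<open>This allows every fact below about residuals of \<open>N\<close> to be used for the zero
  submodule too.\<close>

lemma submodule_zero: "submodule {\<zero>\<^bsub>M\<^esub>} R M"
  by (rule submoduleI) auto

lemma submodule_zero_mem: "submodule N R M \<Longrightarrow> \<zero>\<^bsub>M\<^esub> \<in> N"
  using subgroup.one_closed submodule.axioms(1) by fastforce

text \<open>Each closure property of the residual is the corresponding one of \<open>N\<close>,
  applied at every point of \<open>X\<close>; hence \<open>X\<close> may be any subset of the
  module.\<close>

lemma colon_set_ideal:
  assumes N: "submodule N R M" and X: "X \<subseteq> carrier M"
  shows "ideal (colon_set R M N X) R"
proof (rule idealI)
  show "subgroup (colon_set R M N X) (add_monoid R)"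
  proof (rule R.add.subgroupI)
    show "colon_set R M N X \<noteq> {}"
      using X submodule_zero_mem[OF N] by (auto simp: colon_set_def subset_iff intro!: exI[of _ \<zero>])
  next
    fix a assume "a \<in> colon_set R M N X"
    then show "\<ominus> a \<in> colon_set R M N X"
      using X submoduleE(3)[OF N] by (auto simp: colon_set_def subset_iff smult_l_minus)
  next
    fix a b assume "a \<in> colon_set R M N X" "b \<in> colon_set R M N X"
    then show "a \<oplus> b \<in> colon_set R M N X"
      using X submoduleE(5)[OF N] by (auto simp: colon_set_def subset_iff smult_l_distr)
  qed (auto simp: colon_set_def)
next
  fix a x assume a: "a \<in> colon_set R M N X" and x: "x \<in> carrier R"
  then show *: "x \<otimes> a \<in> colon_set R M N X"
    using X submoduleE(4)[OF N] by (auto simp: colon_set_def subset_iff smult_assoc1)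
  show "a \<otimes> x \<in> colon_set R M N X"
    using * a x by (simp add: colon_set_def R.m_comm)
qed (rule R.ring_axioms)

lemma colon_elem_ideal:
  assumes "submodule N R M" "m \<in> carrier M"
  shows "ideal (colon_elem R M N m) R"
  using colon_set_ideal[OF assms(1), of "{m}"] assms(2)
  by (simp add: colon_elem_def colon_set_def)

lemma smult_commute:
  "a \<in> carrier R \<Longrightarrow> b \<in> carrier R \<Longrightarrow> m \<in> carrier M \<Longrightarrow>
    a \<odot>\<^bsub>M\<^esub> (b \<odot>\<^bsub>M\<^esub> m) = b \<odot>\<^bsub>M\<^esub> (a \<odot>\<^bsub>M\<^esub> m)"
  by (metis R.m_comm smult_assoc1)

text \<open>Moves a condition on a submodule of \<open>M\<close> to an inclusion between ideals of
  \<open>R\<close>, where an equality of residuals can be substituted directly.\<close>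

lemma ideal_smult_subset_iff:
  assumes "ideal I R"
  shows "ideal_smult M I m \<subseteq> N \<longleftrightarrow> I \<subseteq> colon_elem R M N m"
  using ideal.Icarr[OF assms] by (auto simp: ideal_smult_def colon_elem_def)

lemma ideal_smult_carrier:
  assumes "ideal I R" "m \<in> carrier M"
  shows "ideal_smult M I m \<subseteq> carrier M"
  using ideal.Icarr[OF assms(1)] assms(2) by (auto simp: ideal_smult_def)

lemma zero_in_ideal_smult:
  assumes "ideal I R" "m \<in> carrier M"
  shows "\<zero>\<^bsub>M\<^esub> \<in> ideal_smult M I m"
  unfolding ideal_smult_def
  using additive_subgroup.zero_closed[OF ideal.axioms(1)[OF assms(1)]] assms(2)
  by (auto intro!: image_eqI[of _ _ \<zero>])

text \<open>Rewrites a nonvanishing hypothesis as a failed inclusion in the zero submodule, so that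
  the inclusion criteria for a general \<open>N\<close> also handle it.\<close>

lemma ideal_smult_eq_zero_iff:
  assumes "ideal I R" "m \<in> carrier M"
  shows "ideal_smult M I m = {\<zero>\<^bsub>M\<^esub>} \<longleftrightarrow> ideal_smult M I m \<subseteq> {\<zero>\<^bsub>M\<^esub>}"
  using zero_in_ideal_smult[OF assms] by auto

lemma scalar_smult_eq_zero_iff:
  assumes "ideal I R" "m \<in> carrier M" "a \<in> carrier R"
  shows "scalar_smult M a (ideal_smult M I m) = {\<zero>\<^bsub>M\<^esub>} \<longleftrightarrow>
    scalar_smult M a (ideal_smult M I m) \<subseteq> {\<zero>\<^bsub>M\<^esub>}"
  using zero_in_ideal_smult[OF assms(1,2)] by (auto simp: scalar_smult_def intro: image_eqI[of _ _ "\<zero>\<^bsub>M\<^esub>"] simp: assms(3))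

text \<open>Scalars commute, so \<open>a\<close> can be moved past the elements of \<open>I\<close>
  onto \<open>m\<close>: the submodule \<open>aIm\<close> is \<open>I(am)\<close>.\<close>

lemma scalar_smult_subset_iff:
  assumes "ideal I R" "m \<in> carrier M" "a \<in> carrier R"
  shows "scalar_smult M a (ideal_smult M I m) \<subseteq> N \<longleftrightarrow> I \<subseteq> colon_elem R M N (a \<odot>\<^bsub>M\<^esub> m)"
  using ideal.Icarr[OF assms(1)] assms(2,3)
  by (auto simp: scalar_smult_def ideal_smult_def colon_elem_def image_subset_iff
      smult_commute[of a])

lemma mem_colon_set_ideal_smult_iff:
  assumes "a \<in> carrier R"
  shows "a \<in> colon_set R M N (ideal_smult M I m) \<longleftrightarrow> scalar_smult M a (ideal_smult M I m) \<subseteq> N"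
  using assms by (simp add: colon_set_def scalar_smult_def)

text \<open>Since \<open>(N : m)\<close> is an ideal, it suffices to test the products
  \<open>i \<otimes> j\<close>, and \<open>(ij)m = i(jm)\<close> turns this test into one on
  \<open>Jm\<close>.\<close>

lemma ideal_prod_smult_subset_iff:
  assumes N: "submodule N R M" and I: "ideal I R" and J: "ideal J R" and m: "m \<in> carrier M"
  shows "ideal_smult M (ideal_prod R I J) m \<subseteq> N \<longleftrightarrow> I \<subseteq> colon_set R M N (ideal_smult M J m)"
proof -
  have "ideal_smult M (ideal_prod R I J) m \<subseteq> N \<longleftrightarrow>
      (\<forall>i\<in>I. \<forall>j\<in>J. i \<otimes> j \<in> colon_elem R M N m)"
    using ideal_smult_subset_iff[OF R.ideal_prod_is_ideal[OF I J]]
      R.ideal_prod_subset_iff[OF colon_elem_ideal[OF N m]] by simp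
  also have "\<dots> \<longleftrightarrow> I \<subseteq> colon_set R M N (ideal_smult M J m)"
    using ideal.Icarr[OF I] ideal.Icarr[OF J] m
    by (auto simp: colon_elem_def colon_set_def ideal_smult_def subset_iff smult_assoc1)
  finally show ?thesis .
qed

section \<open>Principal ideals: from ideals back to elements\<close>

lemma cgenideal_subset_iff:
  assumes "a \<in> carrier R" "ideal K R"
  shows "PIdl a \<subseteq> K \<longleftrightarrow> a \<in> K"
  using assms R.cgenideal_self R.cgenideal_minimal by blast

lemma cgenideal_smult_subset_iff:
  assumes "submodule N R M" "a \<in> carrier R" "m \<in> carrier M"
  shows "ideal_smult M (PIdl a) m \<subseteq> N \<longleftrightarrow> a \<odot>\<^bsub>M\<^esub> m \<in> N"
  using assms
  by (simp add: ideal_smult_subset_iff R.cgenideal_ideal cgenideal_subset_iff colon_elem_ideal)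
     (simp add: colon_elem_def)

text \<open>The two principal ideals are replaced by their generators one after the other: first
  \<open>a\<close> is tested in the residual of \<open>N\<close> by \<open>(PIdl b)m\<close>, then
  \<open>b\<close> in the residual of \<open>N\<close> by \<open>am\<close>.\<close>

lemma cgenideal_prod_smult_subset_iff:
  assumes "submodule N R M" "a \<in> carrier R" "b \<in> carrier R" "m \<in> carrier M"
  shows "ideal_smult M (ideal_prod R (PIdl a) (PIdl b)) m \<subseteq> N \<longleftrightarrow> (a \<otimes> b) \<odot>\<^bsub>M\<^esub> m \<in> N"
proof -
  have "ideal_smult M (ideal_prod R (PIdl a) (PIdl b)) m \<subseteq> N \<longleftrightarrow>
      a \<in> colon_set R M N (ideal_smult M (PIdl b) m)"
    using assms ideal_smult_carrier[OF R.cgenideal_ideal]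
    by (simp add: ideal_prod_smult_subset_iff R.cgenideal_ideal cgenideal_subset_iff
        colon_set_ideal)
  also have "\<dots> \<longleftrightarrow> PIdl b \<subseteq> colon_elem R M N (a \<odot>\<^bsub>M\<^esub> m)"
    using assms by (simp add: mem_colon_set_ideal_smult_iff scalar_smult_subset_iff R.cgenideal_ideal)
  also have "\<dots> \<longleftrightarrow> (a \<otimes> b) \<odot>\<^bsub>M\<^esub> m \<in> N"
    using assms
    by (simp add: cgenideal_subset_iff colon_elem_ideal)
       (simp add: colon_elem_def smult_assoc1 smult_commute)
  finally show ?thesis .
qed

end

section \<open>Equivalence of the elementwise, residual and ideal conditions\<close>

theorem theorem2p17:
  fixes R :: "('r, 'p) ring_scheme"
    and M :: "('r, 'm, 'q) module_scheme"
    and N :: "'m set"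
  assumes "module R M"
    and "\<one>\<^bsub>R\<^esub> \<noteq> \<zero>\<^bsub>R\<^esub>"
    and "submodule N R M"
    and "N \<noteq> carrier M"
  shows
    "(weakly_classical_prime R M N \<longleftrightarrow>
        (\<forall>a \<in> carrier R. \<forall>b \<in> carrier R.
           colon_module M N (a \<otimes>\<^bsub>R\<^esub> b) =
             colon_module M {\<zero>\<^bsub>M\<^esub>} (a \<otimes>\<^bsub>R\<^esub> b) \<union> colon_module M N a \<union> colon_module M N b))
     \<and>
     (weakly_classical_prime R M N \<longleftrightarrow>
        (\<forall>a \<in> carrier R. \<forall>m \<in> carrier M. a \<odot>\<^bsub>M\<^esub> m \<notin> N \<longrightarrow>
           colon_elem R M N (a \<odot>\<^bsub>M\<^esub> m) =
             colon_elem R M {\<zero>\<^bsub>M\<^esub>} (a \<odot>\<^bsub>M\<^esub> m) \<union> colon_elem R M N m))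
     \<and>
     (weakly_classical_prime R M N \<longleftrightarrow>
        (\<forall>a \<in> carrier R. \<forall>m \<in> carrier M. a \<odot>\<^bsub>M\<^esub> m \<notin> N \<longrightarrow>
           colon_elem R M N (a \<odot>\<^bsub>M\<^esub> m) = colon_elem R M {\<zero>\<^bsub>M\<^esub>} (a \<odot>\<^bsub>M\<^esub> m) \<or>
           colon_elem R M N (a \<odot>\<^bsub>M\<^esub> m) = colon_elem R M N m))
     \<and>
     (weakly_classical_prime R M N \<longleftrightarrow>
        (\<forall>a \<in> carrier R. \<forall>I. ideal I R \<longrightarrow> (\<forall>m \<in> carrier M.
           scalar_smult M a (ideal_smult M I m) \<noteq> {\<zero>\<^bsub>M\<^esub>} \<longrightarrow>
           scalar_smult M a (ideal_smult M I m) \<subseteq> N \<longrightarrow>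
           a \<odot>\<^bsub>M\<^esub> m \<in> N \<or> ideal_smult M I m \<subseteq> N)))
     \<and>
     (weakly_classical_prime R M N \<longleftrightarrow>
        (\<forall>I. ideal I R \<longrightarrow> (\<forall>m \<in> carrier M. \<not> ideal_smult M I m \<subseteq> N \<longrightarrow>
           colon_set R M N (ideal_smult M I m) = colon_set R M {\<zero>\<^bsub>M\<^esub>} (ideal_smult M I m) \<or>
           colon_set R M N (ideal_smult M I m) = colon_elem R M N m)))
     \<and>
     (weakly_classical_prime R M N \<longleftrightarrow>
        (\<forall>I J. ideal I R \<longrightarrow> ideal J R \<longrightarrow> (\<forall>m \<in> carrier M.
           ideal_smult M (ideal_prod R I J) m \<noteq> {\<zero>\<^bsub>M\<^esub>} \<longrightarrow>
           ideal_smult M (ideal_prod R I J) m \<subseteq> N \<longrightarrow>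
           ideal_smult M I m \<subseteq> N \<or> ideal_smult M J m \<subseteq> N)))"
proof -
  interpret module R M by fact
  note N = assms(3)
  note Z = submodule_zero
  have zN: "\<zero>\<^bsub>M\<^esub> \<in> N" using N by (rule submodule_zero_mem)
  have NM: "\<And>a x. a \<in> carrier R \<Longrightarrow> x \<in> N \<Longrightarrow> a \<odot>\<^bsub>M\<^esub> x \<in> N"
    using submoduleE(4)[OF N] .
  \<comment> \<open>The defining implication with \<open>(ab)m\<close> written as
    \<open>a(bm)\<close> and the nonzero hypothesis moved into the conclusion as a disjunct. In this
    form it reads directly as membership of \<open>a\<close> in \<open>(N : bm)\<close>.\<close>
  let ?C1 = "\<forall>a \<in> carrier R. \<forall>b \<in> carrier R. \<forall>m \<in> carrier M.
    a \<odot>\<^bsub>M\<^esub> (b \<odot>\<^bsub>M\<^esub> m) \<in> N \<longrightarrow>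
    a \<odot>\<^bsub>M\<^esub> (b \<odot>\<^bsub>M\<^esub> m) = \<zero>\<^bsub>M\<^esub> \<or> a \<odot>\<^bsub>M\<^esub> m \<in> N \<or> b \<odot>\<^bsub>M\<^esub> m \<in> N"
  let ?C2 = "\<forall>a \<in> carrier R. \<forall>b \<in> carrier R.
    colon_module M N (a \<otimes>\<^bsub>R\<^esub> b) =
      colon_module M {\<zero>\<^bsub>M\<^esub>} (a \<otimes>\<^bsub>R\<^esub> b) \<union> colon_module M N a \<union> colon_module M N b"
  let ?C3 = "\<forall>a \<in> carrier R. \<forall>m \<in> carrier M. a \<odot>\<^bsub>M\<^esub> m \<notin> N \<longrightarrow>
    colon_elem R M N (a \<odot>\<^bsub>M\<^esub> m) =
      colon_elem R M {\<zero>\<^bsub>M\<^esub>} (a \<odot>\<^bsub>M\<^esub> m) \<union> colon_elem R M N m"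
  let ?C4 = "\<forall>a \<in> carrier R. \<forall>m \<in> carrier M. a \<odot>\<^bsub>M\<^esub> m \<notin> N \<longrightarrow>
    colon_elem R M N (a \<odot>\<^bsub>M\<^esub> m) = colon_elem R M {\<zero>\<^bsub>M\<^esub>} (a \<odot>\<^bsub>M\<^esub> m) \<or>
    colon_elem R M N (a \<odot>\<^bsub>M\<^esub> m) = colon_elem R M N m"
  let ?C5 = "\<forall>a \<in> carrier R. \<forall>I. ideal I R \<longrightarrow> (\<forall>m \<in> carrier M.
    scalar_smult M a (ideal_smult M I m) \<noteq> {\<zero>\<^bsub>M\<^esub>} \<longrightarrow>
    scalar_smult M a (ideal_smult M I m) \<subseteq> N \<longrightarrow>
    a \<odot>\<^bsub>M\<^esub> m \<in> N \<or> ideal_smult M I m \<subseteq> N)"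
  let ?C6 = "\<forall>I. ideal I R \<longrightarrow> (\<forall>m \<in> carrier M. \<not> ideal_smult M I m \<subseteq> N \<longrightarrow>
    colon_set R M N (ideal_smult M I m) = colon_set R M {\<zero>\<^bsub>M\<^esub>} (ideal_smult M I m) \<or>
    colon_set R M N (ideal_smult M I m) = colon_elem R M N m)"
  let ?C7 = "\<forall>I J. ideal I R \<longrightarrow> ideal J R \<longrightarrow> (\<forall>m \<in> carrier M.
    ideal_smult M (ideal_prod R I J) m \<noteq> {\<zero>\<^bsub>M\<^esub>} \<longrightarrow>
    ideal_smult M (ideal_prod R I J) m \<subseteq> N \<longrightarrow>
    ideal_smult M I m \<subseteq> N \<or> ideal_smult M J m \<subseteq> N)"
  have one: "weakly_classical_prime R M N \<longleftrightarrow> ?C1"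
    using N assms(4) by (auto simp: weakly_classical_prime_def smult_assoc1)
  have twoI: ?C2 if c: ?C1
  proof (intro ballI)
    fix a b assume ab: "a \<in> carrier R" "b \<in> carrier R"
    show "colon_module M N (a \<otimes>\<^bsub>R\<^esub> b) =
      colon_module M {\<zero>\<^bsub>M\<^esub>} (a \<otimes>\<^bsub>R\<^esub> b) \<union> colon_module M N a \<union> colon_module M N b"
    proof
      show "colon_module M N (a \<otimes>\<^bsub>R\<^esub> b) \<subseteq>
        colon_module M {\<zero>\<^bsub>M\<^esub>} (a \<otimes>\<^bsub>R\<^esub> b) \<union> colon_module M N a \<union> colon_module M N b"
        using c ab by (fastforce simp: colon_module_def smult_assoc1)
      show "colon_module M {\<zero>\<^bsub>M\<^esub>} (a \<otimes>\<^bsub>R\<^esub> b) \<union> colon_module M N a \<union> colon_module M N b \<subseteq>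
        colon_module M N (a \<otimes>\<^bsub>R\<^esub> b)"
        using ab NM[of b] NM[of a] zN
        by (auto simp: colon_module_def smult_assoc1 smult_commute[of a b])
           (simp add: smult_commute[of b a])
    qed
  qed
  have twoE: ?C1 if c: ?C2
  proof (intro ballI impI)
    fix a b m assume ab: "a \<in> carrier R" "b \<in> carrier R" and m: "m \<in> carrier M"
      and "a \<odot>\<^bsub>M\<^esub> (b \<odot>\<^bsub>M\<^esub> m) \<in> N"
    then have "m \<in> colon_module M N (a \<otimes>\<^bsub>R\<^esub> b)"
      by (simp add: colon_module_def smult_assoc1)
    with c ab have "m \<in> colon_module M {\<zero>\<^bsub>M\<^esub>} (a \<otimes>\<^bsub>R\<^esub> b) \<union> colon_module M N a \<union> colon_module M N b"
      by blast
    then show "a \<odot>\<^bsub>M\<^esub> (b \<odot>\<^bsub>M\<^esub> m) = \<zero>\<^bsub>M\<^esub> \<or> a \<odot>\<^bsub>M\<^esub> m \<in> N \<or> b \<odot>\<^bsub>M\<^esub> m \<in> N"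
      using ab by (auto simp: colon_module_def smult_assoc1)
  qed
  have three: ?C3 if c: ?C1
  proof (intro ballI impI equalityI)
    fix a m assume a: "a \<in> carrier R" and m: "m \<in> carrier M" and "a \<odot>\<^bsub>M\<^esub> m \<notin> N"
    \<comment> \<open>For \<open>r\<close> in \<open>(N : am)\<close>, apply \<open>?C1\<close> to
      the pair \<open>r\<close>, \<open>a\<close>; the case \<open>am \<in> N\<close> is excluded,
      leaving \<open>r(am) = 0\<close> or \<open>rm \<in> N\<close>.\<close>
    then show "colon_elem R M N (a \<odot>\<^bsub>M\<^esub> m) \<subseteq>
        colon_elem R M {\<zero>\<^bsub>M\<^esub>} (a \<odot>\<^bsub>M\<^esub> m) \<union> colon_elem R M N m"
      using c by (auto simp: colon_elem_def)
    show "colon_elem R M {\<zero>\<^bsub>M\<^esub>} (a \<odot>\<^bsub>M\<^esub> m) \<union> colon_elem R M N m \<subseteq>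
        colon_elem R M N (a \<odot>\<^bsub>M\<^esub> m)"
      using a m zN NM by (auto simp: colon_elem_def smult_commute[of _ a])
  qed
  have four: ?C4 if c: ?C3
  proof (intro ballI impI)
    fix a m assume a: "a \<in> carrier R" and m: "m \<in> carrier M" and am: "a \<odot>\<^bsub>M\<^esub> m \<notin> N"
    then have "colon_elem R M N (a \<odot>\<^bsub>M\<^esub> m) =
        colon_elem R M {\<zero>\<^bsub>M\<^esub>} (a \<odot>\<^bsub>M\<^esub> m) \<union> colon_elem R M N m"
      using c by blast
    then show "colon_elem R M N (a \<odot>\<^bsub>M\<^esub> m) = colon_elem R M {\<zero>\<^bsub>M\<^esub>} (a \<odot>\<^bsub>M\<^esub> m) \<or>
        colon_elem R M N (a \<odot>\<^bsub>M\<^esub> m) = colon_elem R M N m"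
      \<comment> \<open>The union is an ideal because it equals \<open>(N : am)\<close>, so it
        coincides with one of its two members.\<close>
      using ideal_eq_union_cases[OF colon_elem_ideal[OF Z] colon_elem_ideal[OF N], of "a \<odot>\<^bsub>M\<^esub> m" m]
        colon_elem_ideal[OF N, of "a \<odot>\<^bsub>M\<^esub> m"] a m by simp
  qed
  have five: ?C5 if c: ?C4
  proof (intro ballI allI impI)
    fix a I m assume a: "a \<in> carrier R" and I: "ideal I R" and m: "m \<in> carrier M"
      and nz: "scalar_smult M a (ideal_smult M I m) \<noteq> {\<zero>\<^bsub>M\<^esub>}"
      and sub: "scalar_smult M a (ideal_smult M I m) \<subseteq> N"
    \<comment> \<open>The second fact rules out \<open>(N : am) = (0 : am)\<close>. If
      \<open>am \<notin> N\<close>, then \<open>(N : am) = (N : m)\<close> remains, and the first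
      fact gives \<open>Im \<subseteq> N\<close>.\<close>
    have "I \<subseteq> colon_elem R M N (a \<odot>\<^bsub>M\<^esub> m)" "\<not> I \<subseteq> colon_elem R M {\<zero>\<^bsub>M\<^esub>} (a \<odot>\<^bsub>M\<^esub> m)"
      using sub nz scalar_smult_eq_zero_iff[OF I m a] scalar_smult_subset_iff[OF I m a] by auto
    then show "a \<odot>\<^bsub>M\<^esub> m \<in> N \<or> ideal_smult M I m \<subseteq> N"
      using c a m ideal_smult_subset_iff[OF I] by metis
  qed
  have six: ?C6 if c: ?C5
  proof (intro ballI allI impI)
    fix I m assume I: "ideal I R" and m: "m \<in> carrier M" and Im: "\<not> ideal_smult M I m \<subseteq> N"
    let ?X = "ideal_smult M I m"
    have X: "?X \<subseteq> carrier M" using I m by (rule ideal_smult_carrier)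
    have "colon_set R M N ?X = colon_set R M {\<zero>\<^bsub>M\<^esub>} ?X \<union> colon_elem R M N m"
    proof
      show "colon_set R M N ?X \<subseteq> colon_set R M {\<zero>\<^bsub>M\<^esub>} ?X \<union> colon_elem R M N m"
      proof
        fix r assume r: "r \<in> colon_set R M N ?X"
        then have rR: "r \<in> carrier R" by (simp add: colon_set_def)
        \<comment> \<open>\<open>?C5\<close> with scalar \<open>r\<close>: its remaining alternative
          \<open>Im \<subseteq> N\<close> is excluded by \<open>Im\<close>.\<close>
        have "r \<odot>\<^bsub>M\<^esub> m \<in> N \<or> scalar_smult M r ?X = {\<zero>\<^bsub>M\<^esub>}"
          using c rR I m Im r mem_colon_set_ideal_smult_iff[OF rR] by blast
        then show "r \<in> colon_set R M {\<zero>\<^bsub>M\<^esub>} ?X \<union> colon_elem R M N m"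
          using rR mem_colon_set_ideal_smult_iff[OF rR] by (auto simp: colon_elem_def)
      qed
      show "colon_set R M {\<zero>\<^bsub>M\<^esub>} ?X \<union> colon_elem R M N m \<subseteq> colon_set R M N ?X"
      proof (rule Un_least)
        show "colon_set R M {\<zero>\<^bsub>M\<^esub>} ?X \<subseteq> colon_set R M N ?X"
          using zN by (auto simp: colon_set_def)
        \<comment> \<open>If \<open>rm \<in> N\<close>, then \<open>r(im) = i(rm)\<close> lies in
          \<open>N\<close> for every \<open>i\<close> in \<open>I\<close>.\<close>
        show "colon_elem R M N m \<subseteq> colon_set R M N ?X"
          using NM ideal.Icarr[OF I] m
          by (auto simp: colon_set_def colon_elem_def ideal_smult_def smult_commute[of _ _ m])
             (metis smult_commute)
      qed
    qed
    then show "colon_set R M N ?X = colon_set R M {\<zero>\<^bsub>M\<^esub>} ?X \<or> colon_set R M N ?X = colon_elem R M N m"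
      using ideal_eq_union_cases[OF colon_set_ideal[OF Z X] colon_elem_ideal[OF N m]]
        colon_set_ideal[OF N X] by simp
  qed
  have seven: ?C7 if c: ?C6
  proof (intro ballI allI impI)
    fix I J m assume I: "ideal I R" and J: "ideal J R" and m: "m \<in> carrier M"
      and nz: "ideal_smult M (ideal_prod R I J) m \<noteq> {\<zero>\<^bsub>M\<^esub>}"
      and sub: "ideal_smult M (ideal_prod R I J) m \<subseteq> N"
    \<comment> \<open>\<open>?C6\<close> is applied to \<open>J\<close>, while \<open>I\<close>
      tests the resulting alternative: equality with the zero residual contradicts the second fact,
      and equality with \<open>(N : m)\<close> gives \<open>Im \<subseteq> N\<close>.\<close>
    have "I \<subseteq> colon_set R M N (ideal_smult M J m)"
      "\<not> I \<subseteq> colon_set R M {\<zero>\<^bsub>M\<^esub>} (ideal_smult M J m)"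
      using sub nz ideal_prod_smult_subset_iff[OF N I J m] ideal_prod_smult_subset_iff[OF Z I J m]
        ideal_smult_eq_zero_iff[OF R.ideal_prod_is_ideal[OF I J] m] by auto
    then show "ideal_smult M I m \<subseteq> N \<or> ideal_smult M J m \<subseteq> N"
      using c J m ideal_smult_subset_iff[OF I] by metis
  qed
  have one_if_seven: ?C1 if c: ?C7
  proof (intro ballI impI)
    fix a b m assume a: "a \<in> carrier R" and b: "b \<in> carrier R" and m: "m \<in> carrier M"
      and abm: "a \<odot>\<^bsub>M\<^esub> (b \<odot>\<^bsub>M\<^esub> m) \<in> N"
    let ?P = "ideal_prod R (PIdl\<^bsub>R\<^esub> a) (PIdl\<^bsub>R\<^esub> b)"
    have "ideal_smult M ?P m \<subseteq> N"
      using abm cgenideal_prod_smult_subset_iff[OF N a b m] a b m by (simp add: smult_assoc1)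
    then have "ideal_smult M ?P m = {\<zero>\<^bsub>M\<^esub>} \<or>
        ideal_smult M (PIdl\<^bsub>R\<^esub> a) m \<subseteq> N \<or> ideal_smult M (PIdl\<^bsub>R\<^esub> b) m \<subseteq> N"
      using c R.cgenideal_ideal[OF a] R.cgenideal_ideal[OF b] m by blast
    \<comment> \<open>The criterion for principal products is used a second time with the zero
      submodule as \<open>N\<close>, which turns the vanishing of the product submodule into
      \<open>a(bm) = 0\<close>.\<close>
    then show "a \<odot>\<^bsub>M\<^esub> (b \<odot>\<^bsub>M\<^esub> m) = \<zero>\<^bsub>M\<^esub> \<or> a \<odot>\<^bsub>M\<^esub> m \<in> N \<or> b \<odot>\<^bsub>M\<^esub> m \<in> N"
      using cgenideal_prod_smult_subset_iff[OF Z a b m] cgenideal_smult_subset_iff[OF N _ m] a b m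
      by (auto simp: smult_assoc1)
  qed
  have "?C1 \<longleftrightarrow> ?C2" using twoI twoE by (rule iffI)
  \<comment> \<open>The implications run in a cycle from \<open>?C1\<close> through
    \<open>?C3\<close> to \<open>?C7\<close> and back, so the remaining step is propositional;
    \<open>?C2\<close> is tied to \<open>?C1\<close> separately.\<close>
  have "?C1 \<longleftrightarrow> ?C3" "?C1 \<longleftrightarrow> ?C4" "?C1 \<longleftrightarrow> ?C5"
    "?C1 \<longleftrightarrow> ?C6" "?C1 \<longleftrightarrow> ?C7"
    using three four five six seven one_if_seven by argo+
  show ?thesis
    unfolding one by (intro conjI) fact+
qed

end
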